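(* Let $k\ge 1$ and suppose there exists a $(v,k,1)$-difference set in some finite abelian group of order $v$. Then there exists a set of $v$ equiangular lines in $\mathbb{C}^k$.
   Context: Let $G$ be a finite group of order $v$. In the complex group algebra $\mathbb{C}[G]$ identify a subset $S\subseteq G$ with $\sum_{g\in S}g$, and write $S^{-1}=\sum_{g\in S}g^{-1}$; $1_G$ denotes the identity of $G$. A subset $D\subseteq G$ with $|D|=k$ is a $(v,k,\lambda)$-difference set if $DD^{-1}=k\,1_G+\lambda\,(G\setminus\{1_G\})$ in $\mathbb{C}[G]$. A set of $m$ (distinct) lines (one-dimensional subspaces) in $\mathbb{C}^d$, spanned by unit vectors $z_1,\dots,z_m$, is equiangular if there is a constant $a$ such that $|\langle z_i,z_j\rangle|=a$ for all $i\neq j$. *)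

theory Defs
  imports "HOL-Analysis.Analysis" "HOL-Algebra.Coset" "HOL-Algebra.Module"
begin

(* The complex group algebra of a finite group: complex-valued functions on the carrier
   (extended by undefined outside it), the function f standing for the formal
   sum of f g * g over g in G.  Multiplication is convolution. *)
definition group_algebra :: "('g, 'm) monoid_scheme \<Rightarrow> (complex, 'g \<Rightarrow> complex) module" where
  "group_algebra G =
     \<lparr>carrier = carrier G \<rightarrow>\<^sub>E UNIV,
      mult = (\<lambda>f h. \<lambda>x\<in>carrier G. \<Sum>y\<in>carrier G. f y * h (inv\<^bsub>G\<^esub> y \<otimes>\<^bsub>G\<^esub> x)),
      one = (\<lambda>x\<in>carrier G. if x = \<one>\<^bsub>G\<^esub> then 1 else 0),
      zero = (\<lambda>x\<in>carrier G. 0),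
      add = (\<lambda>f h. \<lambda>x\<in>carrier G. f x + h x),
      smult = (\<lambda>c f. \<lambda>x\<in>carrier G. c * f x)\<rparr>"

definition ga_basis :: "('g, 'm) monoid_scheme \<Rightarrow> 'g \<Rightarrow> 'g \<Rightarrow> complex" where
  "ga_basis G g = (\<lambda>x\<in>carrier G. if x = g then 1 else 0)"

definition ga_set :: "('g, 'm) monoid_scheme \<Rightarrow> 'g set \<Rightarrow> 'g \<Rightarrow> complex" where
  "ga_set G S = (\<lambda>x\<in>carrier G. \<Sum>g\<in>S. ga_basis G g x)"

definition ga_set_inv :: "('g, 'm) monoid_scheme \<Rightarrow> 'g set \<Rightarrow> 'g \<Rightarrow> complex" where
  "ga_set_inv G S = (\<lambda>x\<in>carrier G. \<Sum>g\<in>S. ga_basis G (inv\<^bsub>G\<^esub> g) x)"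

(* The convolution above extends the group multiplication bilinearly. *)
lemma ga_basis_mult:
  fixes G (structure)
  assumes "group G" and "finite (carrier G)" and g: "g \<in> carrier G" and h: "h \<in> carrier G"
  shows "ga_basis G g \<otimes>\<^bsub>group_algebra G\<^esub> ga_basis G h = ga_basis G (g \<otimes> h)"
proof
  interpret group G by fact
  fix x
  show "(ga_basis G g \<otimes>\<^bsub>group_algebra G\<^esub> ga_basis G h) x = ga_basis G (g \<otimes> h) x"
  proof (cases "x \<in> carrier G")
    case x: True
    have "(\<Sum>y\<in>carrier G. ga_basis G g y * ga_basis G h (inv y \<otimes> x))
        = (\<Sum>y\<in>carrier G. if y = g then ga_basis G h (inv g \<otimes> x) else 0)"
      by (rule sum.cong) (auto simp: ga_basis_def)
    also have "\<dots> = ga_basis G h (inv g \<otimes> x)"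
      using assms(2) g by simp
    also have "\<dots> = ga_basis G (g \<otimes> h) x"
      using g h x by (auto simp: ga_basis_def inv_solve_left')
    finally show ?thesis
      using x by (simp add: group_algebra_def)
  qed (simp add: group_algebra_def ga_basis_def)
qed

definition difference_set ::
    "('g, 'm) monoid_scheme \<Rightarrow> 'g set \<Rightarrow> nat \<Rightarrow> nat \<Rightarrow> nat \<Rightarrow> bool" where
  "difference_set G D v k l \<longleftrightarrow>
     group G \<and> finite (carrier G) \<and> Coset.order G = v \<and> D \<subseteq> carrier G \<and> card D = k \<and>
     ga_set G D \<otimes>\<^bsub>group_algebra G\<^esub> ga_set_inv G D =
       (of_nat k \<odot>\<^bsub>group_algebra G\<^esub> ga_basis G \<one>\<^bsub>G\<^esub>)
       \<oplus>\<^bsub>group_algebra G\<^esub>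
       (of_nat l \<odot>\<^bsub>group_algebra G\<^esub> ga_set G (carrier G - {\<one>\<^bsub>G\<^esub>}))"

(* The library's inner product on complex ^ 'n is the real one, hence the Hermitian product here.
   Its induced norm is the library norm.  The prefix vec selects linear algebra over the
   complex scalars; plain span and dim would be over the reals. *)
definition hermitian_inner :: "complex ^ 'n \<Rightarrow> complex ^ 'n \<Rightarrow> complex" where
  "hermitian_inner z w = (\<Sum>i\<in>UNIV. z $ i * cnj (w $ i))"

lemma hermitian_inner_self: "hermitian_inner z z = of_real ((norm z)\<^sup>2)"
  by (simp add: hermitian_inner_def norm_vec_def L2_set_def sum_nonneg flip: complex_norm_square)

definition complex_line :: "(complex ^ 'n) set \<Rightarrow> bool" where
  "complex_line L \<longleftrightarrow> vec.subspace L \<and> vec.dim L = 1"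

(* The value |<z,w>| does not depend on the choice of the spanning unit vectors z, w, so
   quantifying over all of them agrees with fixing one for each line. *)
definition equiangular_lines :: "(complex ^ 'n) set set \<Rightarrow> bool" where
  "equiangular_lines X \<longleftrightarrow>
     finite X \<and> (\<forall>L\<in>X. complex_line L) \<and>
     (\<exists>a::real. \<forall>L\<in>X. \<forall>M\<in>X. L \<noteq> M \<longrightarrow>
        (\<forall>z w. norm z = 1 \<and> vec.span {z} = L \<and> norm w = 1 \<and> vec.span {w} = M \<longrightarrow>
           cmod (hermitian_inner z w) = a))"

end

(* The characters of an abelian group G of order v, restricted to D and divided by sqrt k, are
   v unit vectors z_rho in C^k.  The inner product of z_rho and z_psi is phi(D) / k, where
   phi = rho * cnj psi, and applying a nontrivial phi to D D^-1 = k 1 + (G - 1) gives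
   |phi(D)|^2 = k - 1.  Hence all these inner products have modulus sqrt (k - 1) / k < 1.

   That G has v characters follows by adjoining one element at a time: if n is the least
   positive exponent with x^n in H, then a character rho of H extends to the subgroup generated
   by H and x by sending x to any of the n complex n-th roots of rho (x^n). *)

theory Submission
  imports Defs "HOL-Algebra.Multiplicative_Group"
begin

section \<open>Characters of a subgroup and their values\<close>

text \<open>Values are only required to be nonzero; in a finite group they are then roots of unity.
  Membership in \<open>extensional H\<close> makes two characters equal as soon as they agree on
  \<open>H\<close>, so that sets of characters can be counted.\<close>

definition characters :: "('g, 'm) monoid_scheme \<Rightarrow> 'g set \<Rightarrow> ('g \<Rightarrow> complex) set" where
  "characters G H = {\<rho> \<in> extensional H.
     (\<forall>x\<in>H. \<rho> x \<noteq> 0) \<and> (\<forall>x\<in>H. \<forall>y\<in>H. \<rho> (x \<otimes>\<^bsub>G\<^esub> y) = \<rho> x * \<rho> y)}"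

lemma characters_mult:
  "\<rho> \<in> characters G H \<Longrightarrow> x \<in> H \<Longrightarrow> y \<in> H \<Longrightarrow> \<rho> (x \<otimes>\<^bsub>G\<^esub> y) = \<rho> x * \<rho> y"
  by (simp add: characters_def)

lemma characters_nonzero: "\<rho> \<in> characters G H \<Longrightarrow> x \<in> H \<Longrightarrow> \<rho> x \<noteq> 0"
  by (simp add: characters_def)

context group
begin

lemma character_one:
  assumes "subgroup H G" "\<rho> \<in> characters G H"
  shows "\<rho> \<one> = 1"
proof -
  have "\<one> \<in> H" using assms(1) by (rule subgroup.one_closed)
  then have "\<rho> \<one> * \<rho> \<one> = \<rho> \<one>" "\<rho> \<one> \<noteq> 0"
    using characters_mult[OF assms(2), of \<one> \<one>] characters_nonzero[OF assms(2)] by auto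
  then show ?thesis by simp
qed

lemma subgroup_nat_pow_closed:
  assumes "subgroup H G" "x \<in> H"
  shows "x [^] (n::nat) \<in> H"
  using assms by (induction n) (auto simp: subgroup.one_closed subgroup.m_closed)

lemma character_pow:
  assumes "subgroup H G" "\<rho> \<in> characters G H" "x \<in> H"
  shows "\<rho> (x [^] (n::nat)) = \<rho> x ^ n"
  using assms
  by (induction n) (auto simp: character_one characters_mult subgroup_nat_pow_closed)

text \<open>Since \<open>x [^] order G\<close> is the identity, the value at \<open>x\<close> is a
  root of unity.\<close>

lemma character_norm:
  assumes "finite (carrier G)" "\<rho> \<in> characters G (carrier G)" "x \<in> carrier G"
  shows "cmod (\<rho> x) = 1"
proof -
  have "\<rho> x ^ order G = 1"
    using character_pow[OF subgroup_self assms(2,3), of "order G"]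
    by (simp add: pow_order_eq_1 assms(3) character_one[OF subgroup_self assms(2)])
  moreover have "order G > 0" using assms(1) by (simp add: order_gt_0_iff_finite)
  ultimately show ?thesis
    using norm_power[of "\<rho> x" "order G"] power_eq_1_iff[of "cmod (\<rho> x)" "order G"] by simp
qed

text \<open>Both sides are the multiplicative inverse of \<open>\<rho> x\<close>, the right one
  because \<open>\<rho> x\<close> has modulus 1.\<close>

lemma character_inv:
  assumes "finite (carrier G)" "\<rho> \<in> characters G (carrier G)" "x \<in> carrier G"
  shows "\<rho> (inv x) = cnj (\<rho> x)"
proof -
  have "\<rho> x * \<rho> (inv x) = 1"
    using characters_mult[OF assms(2,3), of "inv x"] assms(3)
    by (simp add: character_one[OF subgroup_self assms(2)])
  moreover have "\<rho> x * cnj (\<rho> x) = 1"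
    using character_norm[OF assms] by (simp flip: complex_norm_square)
  ultimately show ?thesis
    using characters_nonzero[OF assms(2,3)] by (metis mult_left_cancel)
qed

text \<open>Translation by \<open>g\<close> permutes the group and multiplies the sum by
  \<open>\<rho> g\<close>, which differs from 1.\<close>

lemma character_sum_zero:
  assumes "finite (carrier G)" "\<rho> \<in> characters G (carrier G)" "g \<in> carrier G" "\<rho> g \<noteq> 1"
  shows "(\<Sum>x\<in>carrier G. \<rho> x) = 0"
proof -
  have "(\<Sum>x\<in>carrier G. \<rho> x) = (\<Sum>x\<in>carrier G. \<rho> (g \<otimes> x))"
    by (rule sum.reindex_bij_witness[where i="\<lambda>x. g \<otimes> x" and j="\<lambda>x. inv g \<otimes> x"])
      (use assms(3) in \<open>auto simp flip: m_assoc\<close>)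
  also have "\<dots> = \<rho> g * (\<Sum>x\<in>carrier G. \<rho> x)"
    using characters_mult[OF assms(2,3)] by (simp add: sum_distrib_left)
  finally show ?thesis using assms(4) by simp
qed

text \<open>Division with remainder: if \<open>x [^] m\<close> and \<open>x [^] n\<close> lie in
  \<open>H\<close>, so does \<open>x [^] (m mod n)\<close>, and minimality of \<open>n\<close>
  forces the remainder to be 0. The exponent \<open>order G\<close> shows that a positive one
  exists.\<close>

lemma exists_least_pow_mem:
  assumes "finite (carrier G)" "subgroup H G" "x \<in> carrier G"
  obtains n :: nat where "n > 0" "x [^] n \<in> H" "\<And>m. x [^] (m::nat) \<in> H \<Longrightarrow> n dvd m"
proof -
  define P where "P = (\<lambda>n::nat. n > 0 \<and> x [^] n \<in> H)"
  define n where "n = (LEAST n. P n)"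
  have "P (order G)"
    using assms by (simp add: P_def order_gt_0_iff_finite pow_order_eq_1 subgroup.one_closed)
  then have n: "P n" unfolding n_def by (rule LeastI)
  have dvd: "n dvd m" if m: "x [^] m \<in> H" for m
  proof -
    let ?a = "(x [^] n) [^] (m div n)"
    have "x [^] m = ?a \<otimes> x [^] (m mod n)"
      using assms(3) by (simp add: nat_pow_pow nat_pow_mult)
    then have "x [^] (m mod n) = inv ?a \<otimes> x [^] m"
      using assms(3) by (simp add: inv_solve_left)
    moreover have "?a \<in> H"
      using n assms(2) by (simp add: P_def subgroup_nat_pow_closed)
    ultimately have "x [^] (m mod n) \<in> H"
      using m subgroup.m_closed[OF assms(2)] subgroup.m_inv_closed[OF assms(2)] by metis
    moreover have "m mod n < n" using n by (simp add: P_def)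
    ultimately have "m mod n = 0"
      using not_less_Least[of "m mod n" P] by (auto simp: n_def P_def)
    then show ?thesis by auto
  qed
  show ?thesis using that n dvd by (auto simp: P_def)
qed

end

section \<open>Adjoining one element to a subgroup\<close>

text \<open>In a finite abelian group this is the subgroup generated by \<open>H\<close> and
  \<open>x\<close>. Natural exponents are enough there, because the inverse of \<open>x\<close> is a
  power of \<open>x\<close>.\<close>

definition adjoin :: "('g, 'm) monoid_scheme \<Rightarrow> 'g set \<Rightarrow> 'g \<Rightarrow> 'g set" where
  "adjoin G H x = (\<lambda>(h, i::nat). h \<otimes>\<^bsub>G\<^esub> x [^]\<^bsub>G\<^esub> i) ` (H \<times> UNIV)"

context comm_group
begin

lemma adjoin_mult:
  assumes "h \<in> carrier G" "h' \<in> carrier G" "x \<in> carrier G"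
  shows "(h \<otimes> x [^] (i::nat)) \<otimes> (h' \<otimes> x [^] (j::nat)) = (h \<otimes> h') \<otimes> x [^] (i + j)"
  using assms by (simp add: m_ac flip: nat_pow_mult)

lemma subgroup_adjoin:
  assumes "finite (carrier G)" "subgroup H G" "x \<in> carrier G"
  shows "subgroup (adjoin G H x) G"
proof -
  note H = subgroup.mem_carrier[OF assms(2)]
  show ?thesis
  proof (rule subgroupI)
    show "adjoin G H x \<subseteq> carrier G" using H assms(3) by (auto simp: adjoin_def)
    show "adjoin G H x \<noteq> {}" using subgroup.one_closed[OF assms(2)] by (auto simp: adjoin_def)
  next
    fix a assume "a \<in> adjoin G H x"
    then obtain h i where a: "a = h \<otimes> x [^] (i::nat)" "h \<in> H" by (auto simp: adjoin_def)
    \<comment> \<open>This exponent makes \<open>i + j\<close> a multiple of the group order, so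
      \<open>x [^] j\<close> is the inverse of \<open>x [^] i\<close> without a negative
      exponent.\<close>
    define j where "j = i * (order G - 1)"
    have "i + j = i * order G"
      using assms(1) order_gt_0_iff_finite by (cases "order G") (auto simp: j_def)
    then have "x [^] (i + j) = (x [^] order G) [^] i"
      using assms(3) by (simp add: nat_pow_pow mult.commute)
    then have "a \<otimes> (inv h \<otimes> x [^] j) = \<one>"
      unfolding a(1) using a(2) assms(3) H by (simp add: adjoin_mult pow_order_eq_1)
    then have "inv a = inv h \<otimes> x [^] j"
      using a H assms(3) by (intro inv_equality) (simp_all add: m_comm)
    then show "inv a \<in> adjoin G H x"
      using subgroup.m_inv_closed[OF assms(2) a(2)] by (auto simp: adjoin_def)
  next
    fix a b assume "a \<in> adjoin G H x" "b \<in> adjoin G H x"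
    then obtain h i h' j where "a = h \<otimes> x [^] (i::nat)" "h \<in> H"
      "b = h' \<otimes> x [^] (j::nat)" "h' \<in> H" by (auto simp: adjoin_def)
    then have "a \<otimes> b = (h \<otimes> h') \<otimes> x [^] (i + j)" "h \<otimes> h' \<in> H"
      using H assms(3) adjoin_mult subgroup.m_closed[OF assms(2)] by auto
    then show "a \<otimes> b \<in> adjoin G H x" by (auto simp: adjoin_def)
  qed
qed

lemma subset_adjoin:
  assumes "subgroup H G" "x \<in> carrier G"
  shows "H \<subseteq> adjoin G H x" "x \<in> adjoin G H x"
proof -
  have "h \<in> adjoin G H x" if "h \<in> H" for h
    using that subgroup.mem_carrier[OF assms(1) that]
    by (auto simp: adjoin_def intro!: image_eqI[of _ _ "(h, 0)"])
  then show "H \<subseteq> adjoin G H x" by auto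
  show "x \<in> adjoin G H x"
    using assms subgroup.one_closed[OF assms(1)]
    by (auto simp: adjoin_def intro!: image_eqI[of _ _ "(\<one>, 1)"])
qed

text \<open>Exponents can be reduced modulo \<open>n\<close>: the surplus is a power of
  \<open>x [^] n\<close>, which is absorbed into the factor from \<open>H\<close>. So at most
  \<open>n\<close> exponents occur for each element of \<open>H\<close>.\<close>

lemma card_adjoin_le:
  assumes "finite H" "subgroup H G" "x \<in> carrier G" "n > 0" "x [^] (n::nat) \<in> H"
  shows "card (adjoin G H x) \<le> n * card H"
proof -
  have "adjoin G H x \<subseteq> (\<lambda>(h, i). h \<otimes> x [^] i) ` (H \<times> {..<n})"
  proof
    fix a assume "a \<in> adjoin G H x"
    then obtain h i where a: "a = h \<otimes> x [^] (i::nat)" "h \<in> H" by (auto simp: adjoin_def)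
    have h: "h \<in> carrier G" using a subgroup.mem_carrier[OF assms(2)] by auto
    let ?b = "h \<otimes> (x [^] n) [^] (i div n)"
    have "x [^] i = (x [^] n) [^] (i div n) \<otimes> x [^] (i mod n)"
      using assms(3) by (simp add: nat_pow_pow nat_pow_mult)
    then have "a = ?b \<otimes> x [^] (i mod n)" using a h assms(3) by (simp add: m_assoc)
    moreover have "?b \<in> H"
      using a assms subgroup_nat_pow_closed subgroup.m_closed by metis
    ultimately show "a \<in> (\<lambda>(h, i). h \<otimes> x [^] i) ` (H \<times> {..<n})"
      using assms(4) by (auto intro!: image_eqI[of _ _ "(?b, i mod n)"])
  qed
  then have "card (adjoin G H x) \<le> card ((\<lambda>(h, i). h \<otimes> x [^] i) ` (H \<times> {..<n}))"
    using assms(1) by (intro card_mono) auto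
  also have "\<dots> \<le> card (H \<times> {..<n})" using assms(1) by (intro card_image_le) auto
  finally show ?thesis by (simp add: card_cartesian_product mult.commute)
qed

section \<open>Extending characters and counting the extensions\<close>

text \<open>The extension must send \<open>h \<otimes> x [^] i\<close> to
  \<open>\<rho> h * c ^ i\<close>. The content is that this value is independent of the chosen
  \<open>h\<close> and \<open>i\<close>, which the condition on \<open>c ^ n\<close> ensures. The
  last two conclusions let the pair of \<open>\<rho>\<close> and \<open>c\<close> be recovered from
  \<open>\<psi>\<close>.\<close>

lemma character_extend:
  assumes "finite (carrier G)" "subgroup H G" "x \<in> carrier G" "\<rho> \<in> characters G H"
    and n: "n > 0" "x [^] (n::nat) \<in> H" "\<And>m. x [^] (m::nat) \<in> H \<Longrightarrow> n dvd m"
    and c: "c ^ n = \<rho> (x [^] n)"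
  obtains \<psi> where "\<psi> \<in> characters G (adjoin G H x)" "restrict \<psi> H = \<rho>" "\<psi> x = c"
proof -
  note H = subgroup.mem_carrier[OF assms(2)]
  have c0: "c \<noteq> 0" using c n(1) characters_nonzero[OF assms(4) n(2)] by (auto simp: power_0_left)
  \<comment> \<open>Cancelling the smaller power leaves \<open>h = h' \<otimes> x [^] d\<close> with
    \<open>d = j - i\<close>. Hence \<open>x [^] d\<close> lies in \<open>H\<close>, so
    \<open>n\<close> divides \<open>d\<close>, and raising \<open>c ^ n = \<rho> (x [^] n)\<close>
    to the power \<open>d div n\<close> gives \<open>\<rho> (x [^] d) = c ^ d\<close>.\<close>
  have le: "\<rho> h * c ^ i = \<rho> h' * c ^ j"
    if "h \<in> H" "h' \<in> H" "h \<otimes> x [^] i = h' \<otimes> x [^] j" "i \<le> j" for h h' and i j :: nat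
  proof -
    obtain d where d: "j = d + i" using \<open>i \<le> j\<close> by (metis le_add_diff_inverse2)
    have "h \<otimes> x [^] i = (h' \<otimes> x [^] d) \<otimes> x [^] i"
      using that H assms(3) by (simp add: d m_assoc flip: nat_pow_mult)
    then have h: "h = h' \<otimes> x [^] d"
      using that H assms(3) by (simp add: right_cancel)
    then have "x [^] d = inv h' \<otimes> h"
      using that H assms(3) by (simp add: inv_solve_left)
    then have "x [^] d \<in> H"
      using that assms(2) by (simp add: subgroup.m_closed subgroup.m_inv_closed)
    then obtain q where q: "d = n * q" using n(3) by (auto elim: dvdE)
    then have "\<rho> (x [^] d) = c ^ d"
      using character_pow[OF assms(2,4) n(2), of q] assms(3) c
      by (simp add: nat_pow_pow power_mult)
    then show ?thesis
      using characters_mult[OF assms(4) \<open>h' \<in> H\<close> \<open>x [^] d \<in> H\<close>]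
      by (simp add: h d power_add)
  qed
  have eq: "\<rho> h * c ^ i = \<rho> h' * c ^ j"
    if "h \<in> H" "h' \<in> H" "h \<otimes> x [^] i = h' \<otimes> x [^] j" for h h' and i j :: nat
    using le[OF that] le[OF that(2,1) that(3)[symmetric]] by (cases "i \<le> j") auto
  \<comment> \<open>The description picks the common value of all representations of
    \<open>a\<close>; its uniqueness is \<open>eq\<close>.\<close>
  define \<psi> where "\<psi> = (\<lambda>a\<in>adjoin G H x.
    THE w. \<exists>h\<in>H. \<exists>i::nat. a = h \<otimes> x [^] i \<and> w = \<rho> h * c ^ i)"
  have \<psi>: "\<psi> (h \<otimes> x [^] i) = \<rho> h * c ^ i" if "h \<in> H" for h and i :: nat
  proof -
    have "h \<otimes> x [^] i \<in> adjoin G H x" using that by (auto simp: adjoin_def)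
    moreover have "(THE w. \<exists>h'\<in>H. \<exists>j::nat. h \<otimes> x [^] i = h' \<otimes> x [^] j \<and> w = \<rho> h' * c ^ j)
        = \<rho> h * c ^ i"
    proof (rule the_equality)
      show "\<exists>h'\<in>H. \<exists>j. h \<otimes> x [^] i = h' \<otimes> x [^] j \<and> \<rho> h * c ^ i = \<rho> h' * c ^ j"
        using that by blast
    next
      fix w assume "\<exists>h'\<in>H. \<exists>j. h \<otimes> x [^] i = h' \<otimes> x [^] j \<and> w = \<rho> h' * c ^ j"
      then obtain h' j where "h' \<in> H" "h \<otimes> x [^] i = h' \<otimes> x [^] (j::nat)" "w = \<rho> h' * c ^ j"
        by blast
      then show "w = \<rho> h * c ^ i" using eq[OF that] by simp
    qed
    ultimately show ?thesis by (simp only: \<psi>_def restrict_apply if_True)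
  qed
  have "\<psi> \<in> characters G (adjoin G H x)"
    unfolding characters_def
  proof (safe)
    show "\<psi> \<in> extensional (adjoin G H x)" by (simp add: \<psi>_def)
  next
    fix a assume "a \<in> adjoin G H x" "\<psi> a = 0"
    then show False using c0 characters_nonzero[OF assms(4)] by (auto simp: adjoin_def \<psi>)
  next
    fix a b assume "a \<in> adjoin G H x" "b \<in> adjoin G H x"
    then obtain h i h' j where "a = h \<otimes> x [^] (i::nat)" "h \<in> H"
      "b = h' \<otimes> x [^] (j::nat)" "h' \<in> H" by (auto simp: adjoin_def)
    then show "\<psi> (a \<otimes> b) = \<psi> a * \<psi> b"
      using H assms(3) characters_mult[OF assms(4)] subgroup.m_closed[OF assms(2)]
      by (simp add: adjoin_mult \<psi> power_add)
  qed
  moreover have "restrict \<psi> H = \<rho>"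
  proof
    fix a
    show "restrict \<psi> H a = \<rho> a"
      using \<psi>[of a 0] H assms(4) by (cases "a \<in> H") (auto simp: characters_def extensional_def)
  qed
  moreover have "\<psi> x = c"
    using \<psi>[of \<one> 1] assms(3) subgroup.one_closed[OF assms(2)]
    by (simp add: character_one[OF assms(2,4)])
  ultimately show ?thesis using that by blast
qed

text \<open>Every character in \<open>S\<close> extends once for each of the \<open>n\<close> roots,
  giving \<open>n * card S\<close> characters, while the subgroup grows by a factor of at most
  \<open>n\<close>. Thus the bound \<open>card H \<le> card S\<close> is inherited by the larger
  subgroup.\<close>

lemma exists_many_characters_adjoin:
  assumes "finite (carrier G)" "subgroup H G" "x \<in> carrier G"
    and S: "S \<subseteq> characters G H" "finite S" "card H \<le> card S"
  obtains T where "T \<subseteq> characters G (adjoin G H x)" "finite T" "card (adjoin G H x) \<le> card T"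
proof -
  obtain n :: nat where n: "n > 0" "x [^] n \<in> H" "\<And>m. x [^] (m::nat) \<in> H \<Longrightarrow> n dvd m"
    using exists_least_pow_mem[OF assms(1-3)] by blast
  \<comment> \<open>The pairs in \<open>R\<close> are the data of an extension: a character on
    \<open>H\<close> and the value prescribed at \<open>x\<close>.\<close>
  define R where "R = (SIGMA \<rho>:S. {c. c ^ n = \<rho> (x [^] n)})"
  have "\<exists>\<psi>. \<psi> \<in> characters G (adjoin G H x) \<and> restrict \<psi> H = fst p \<and> \<psi> x = snd p"
    if "p \<in> R" for p
  proof -
    have "fst p \<in> characters G H" "snd p ^ n = fst p (x [^] n)"
      using that S by (auto simp: R_def)
    then show ?thesis using character_extend[OF assms(1-3) _ n] by metis
  qed
  then have "\<exists>E. \<forall>p\<in>R. E p \<in> characters G (adjoin G H x) \<and>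
      restrict (E p) H = fst p \<and> E p x = snd p"
    by (intro bchoice) blast
  then obtain E where "\<forall>p\<in>R. E p \<in> characters G (adjoin G H x) \<and>
      restrict (E p) H = fst p \<and> E p x = snd p"
    by (rule exE)
  then have E: "E p \<in> characters G (adjoin G H x)" "restrict (E p) H = fst p" "E p x = snd p"
    if "p \<in> R" for p
    using that by simp_all
  have roots: "card {c. c ^ n = \<rho> (x [^] n)} = n" "finite {c. c ^ n = \<rho> (x [^] n)}"
    if "\<rho> \<in> S" for \<rho>
  proof -
    \<comment> \<open>A nonzero complex number has exactly \<open>n\<close> distinct
      \<open>n\<close>-th roots, whereas 0 has only one.\<close>
    have "\<rho> (x [^] n) \<noteq> 0" by (rule characters_nonzero[OF subsetD[OF S(1) that] n(2)])
    then show "card {c. c ^ n = \<rho> (x [^] n)} = n" using n(1) by (rule card_nth_roots)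
    then show "finite {c. c ^ n = \<rho> (x [^] n)}" using n(1) by (auto intro: card_ge_0_finite)
  qed
  have "finite R" using S(2) roots(2) by (auto simp: R_def)
  have "card R = n * card S"
    using S(2) roots by (simp add: R_def mult.commute)
  \<comment> \<open>The restriction to \<open>H\<close> and the value at \<open>x\<close> give back
    both components of the pair.\<close>
  have "inj_on E R"
  proof (rule inj_onI)
    fix p q assume "p \<in> R" "q \<in> R" "E p = E q"
    then show "p = q" using E(2,3) by (metis prod.expand)
  qed
  then have "card (E ` R) = n * card S"
    using \<open>card R = n * card S\<close> by (simp add: card_image)
  moreover have "card (adjoin G H x) \<le> n * card H"
    using card_adjoin_le[OF _ assms(2,3) n(1,2)] finite_subset[OF subgroup.subset[OF assms(2)] assms(1)]
    by blast
  ultimately have "card (adjoin G H x) \<le> card (E ` R)"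
    using S(3) by (metis le_trans mult_le_mono2)
  moreover have "E ` R \<subseteq> characters G (adjoin G H x)" using E(1) by (rule image_subsetI)
  ultimately show ?thesis using that \<open>finite R\<close> by blast
qed

text \<open>Starting from the trivial subgroup, elements outside the current subgroup are adjoined
  until the whole group is reached. The induction carries the inequality
  \<open>card H \<le> card S\<close>; a subset of the exact size is chosen only at the end.\<close>

lemma exists_order_characters:
  assumes "finite (carrier G)"
  obtains S where "S \<subseteq> characters G (carrier G)" "finite S" "card S = order G"
proof -
  have step: "\<exists>T \<subseteq> characters G (carrier G). finite T \<and> card (carrier G) \<le> card T"
    if "subgroup H G" "S \<subseteq> characters G H" "finite S" "card H \<le> card S" for H S
    using that
  proof (induction "order G - card H" arbitrary: H S rule: less_induct)
    case less
    show ?case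
    proof (cases "H = carrier G")
      case False
      note sub = subgroup.subset[OF less.prems(1)]
      obtain x where x: "x \<in> carrier G" "x \<notin> H" using False sub by auto
      note K = subgroup_adjoin[OF assms less.prems(1) x(1)]
      obtain T where T: "T \<subseteq> characters G (adjoin G H x)" "finite T"
        "card (adjoin G H x) \<le> card T"
        using exists_many_characters_adjoin[OF assms less.prems(1) x(1) less.prems(2-4)] by blast
      have fin: "finite (adjoin G H x)" using K assms subgroup.subset finite_subset by metis
      have "card H < card (adjoin G H x)"
        using subset_adjoin[OF less.prems(1) x(1)] x fin by (intro psubset_card_mono) auto
      moreover have "card (adjoin G H x) \<le> order G"
        using subgroup.subset[OF K] assms by (simp add: order_def card_mono)
      ultimately have "order G - card (adjoin G H x) < order G - card H" by simp
      then show ?thesis using less.hyps K T by blast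
    qed (use less.prems in auto)
  qed
  \<comment> \<open>The induction starts with the constant character on the trivial subgroup: one
    character for one element.\<close>
  have "(\<lambda>x\<in>{\<one>}. 1) \<in> characters G {\<one>}" by (simp add: characters_def)
  then obtain T where "T \<subseteq> characters G (carrier G)" "finite T" "order G \<le> card T"
    using step[OF triv_subgroup, of "{\<lambda>x\<in>{\<one>}. 1}"] by (auto simp: order_def)
  then show ?thesis using that by (metis obtain_subset_with_card_n subset_trans)
qed

end

section \<open>Characters on the group algebra and on difference sets\<close>

text \<open>The sums are the values of the linear extension of \<open>\<phi>\<close> to the group
  algebra. It is multiplicative by the substitution \<open>x = y \<otimes> z\<close> in the
  convolution.\<close>

lemma (in group) character_group_algebra_mult:
  assumes "finite (carrier G)" "\<phi> \<in> characters G (carrier G)"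
  shows "(\<Sum>x\<in>carrier G. (f \<otimes>\<^bsub>group_algebra G\<^esub> h) x * \<phi> x)
       = (\<Sum>x\<in>carrier G. f x * \<phi> x) * (\<Sum>x\<in>carrier G. h x * \<phi> x)"
proof -
  have "(\<Sum>x\<in>carrier G. (f \<otimes>\<^bsub>group_algebra G\<^esub> h) x * \<phi> x)
      = (\<Sum>y\<in>carrier G. \<Sum>x\<in>carrier G. f y * h (inv y \<otimes> x) * \<phi> x)"
    by (subst sum.swap) (simp add: group_algebra_def sum_distrib_right)
  also have "\<dots> = (\<Sum>y\<in>carrier G. \<Sum>z\<in>carrier G. (f y * \<phi> y) * (h z * \<phi> z))"
  proof (rule sum.cong[OF refl])
    fix y assume y: "y \<in> carrier G"
    show "(\<Sum>x\<in>carrier G. f y * h (inv y \<otimes> x) * \<phi> x)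
        = (\<Sum>z\<in>carrier G. (f y * \<phi> y) * (h z * \<phi> z))"
      by (rule sum.reindex_bij_witness[where i="\<lambda>z. y \<otimes> z" and j="\<lambda>x. inv y \<otimes> x"])
        (use y in \<open>auto simp flip: m_assoc simp: characters_mult[OF assms(2), symmetric]\<close>)
  qed
  finally show ?thesis by (simp add: sum_product)
qed

lemma sum_ga_basis:
  assumes "finite (carrier G)" "g \<in> carrier G"
  shows "(\<Sum>x\<in>carrier G. ga_basis G g x * \<phi> x) = \<phi> g"
proof -
  have "(\<Sum>x\<in>carrier G. ga_basis G g x * \<phi> x) = (\<Sum>x\<in>carrier G. if x = g then \<phi> g else 0)"
    by (rule sum.cong) (auto simp: ga_basis_def)
  then show ?thesis using assms by simp
qed

lemma sum_ga_set:
  assumes "finite (carrier G)" "S \<subseteq> carrier G"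
  shows "(\<Sum>x\<in>carrier G. ga_set G S x * \<phi> x) = (\<Sum>g\<in>S. \<phi> g)"
proof -
  have "(\<Sum>x\<in>carrier G. ga_set G S x * \<phi> x)
      = (\<Sum>g\<in>S. \<Sum>x\<in>carrier G. ga_basis G g x * \<phi> x)"
    by (subst sum.swap) (simp add: ga_set_def sum_distrib_right)
  then show ?thesis using assms by (simp add: sum_ga_basis subset_iff)
qed

lemma (in group) sum_ga_set_inv:
  assumes "finite (carrier G)" "S \<subseteq> carrier G"
  shows "(\<Sum>x\<in>carrier G. ga_set_inv G S x * \<phi> x) = (\<Sum>g\<in>S. \<phi> (inv g))"
proof -
  have "(\<Sum>x\<in>carrier G. ga_set_inv G S x * \<phi> x)
      = (\<Sum>g\<in>S. \<Sum>x\<in>carrier G. ga_basis G (inv g) x * \<phi> x)"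
    by (subst sum.swap) (simp add: ga_set_inv_def sum_distrib_right)
  then show ?thesis using assms by (simp add: sum_ga_basis subset_iff)
qed

text \<open>The linear extension of \<open>\<phi>\<close> sends \<open>D\<close> to a sum s, its
  inverse set to the conjugate of s, the identity to 1 and the remaining elements together to -1.
  The defining equation of a difference set then reads as a formula for the squared modulus of
  s.\<close>

lemma difference_set_character_sum:
  fixes G (structure)
  assumes D: "difference_set G D v k l"
    and \<phi>: "\<phi> \<in> characters G (carrier G)" "g \<in> carrier G" "\<phi> g \<noteq> 1"
  shows "(cmod (\<Sum>d\<in>D. \<phi> d))\<^sup>2 = real k - real l"
proof -
  interpret group G using D by (simp add: difference_set_def)
  have fin: "finite (carrier G)" and sub: "D \<subseteq> carrier G"
    using D by (auto simp: difference_set_def)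
  let ?s = "\<Sum>d\<in>D. \<phi> d"
  have "(\<Sum>d\<in>D. \<phi> (inv d)) = cnj ?s"
    using sub by (auto simp: character_inv[OF fin \<phi>(1)] intro!: sum.cong)
  then have "?s * cnj ?s
      = (\<Sum>x\<in>carrier G. (ga_set G D \<otimes>\<^bsub>group_algebra G\<^esub> ga_set_inv G D) x * \<phi> x)"
    by (simp add: character_group_algebra_mult[OF fin \<phi>(1)] sum_ga_set[OF fin sub]
        sum_ga_set_inv[OF fin sub])
  also have "\<dots> = of_nat k * (\<Sum>x\<in>carrier G. ga_basis G \<one> x * \<phi> x)
      + of_nat l * (\<Sum>x\<in>carrier G. ga_set G (carrier G - {\<one>}) x * \<phi> x)"
    using D by (simp add: difference_set_def group_algebra_def distrib_right sum.distrib
        sum_distrib_left mult.assoc)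
  also have "\<dots> = of_nat k + of_nat l * (\<Sum>x\<in>carrier G - {\<one>}. \<phi> x)"
    using fin by (simp add: sum_ga_basis sum_ga_set character_one[OF subgroup_self \<phi>(1)])
  \<comment> \<open>The sum over the whole group vanishes, and the identity contributes 1 to
    it.\<close>
  also have "(\<Sum>x\<in>carrier G - {\<one>}. \<phi> x) = -1"
    using character_sum_zero[OF fin \<phi>] fin
    by (simp add: sum_diff1 character_one[OF subgroup_self \<phi>(1)])
  finally have "of_real ((cmod ?s)\<^sup>2) = (of_real (real k - real l) :: complex)"
    unfolding complex_norm_square by simp
  then show ?thesis by (simp only: of_real_eq_iff)
qed

text \<open>Conjugation inverts the values of \<open>\<psi>\<close>, so \<open>\<phi>\<close> is the
  quotient of the two characters. It differs from 1 wherever they disagree.\<close>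

lemma (in group) characters_quotient:
  assumes fin: "finite (carrier G)"
    and \<rho>: "\<rho> \<in> characters G (carrier G)" "\<psi> \<in> characters G (carrier G)" "\<rho> \<noteq> \<psi>"
  obtains \<phi> g where "\<phi> \<in> characters G (carrier G)" "g \<in> carrier G" "\<phi> g \<noteq> 1"
    "\<And>x. x \<in> carrier G \<Longrightarrow> \<phi> x = \<rho> x * cnj (\<psi> x)"
proof -
  let ?\<phi> = "\<lambda>x\<in>carrier G. \<rho> x * cnj (\<psi> x)"
  have "?\<phi> \<in> characters G (carrier G)"
    using \<rho> by (auto simp: characters_def)
  moreover obtain g where g: "g \<in> carrier G" "\<rho> g \<noteq> \<psi> g"
    using \<rho> extensionalityI[of \<rho> "carrier G" \<psi>] by (auto simp: characters_def)
  moreover have "\<psi> g * cnj (\<psi> g) = 1"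
    using character_norm[OF fin \<rho>(2) g(1)] by (simp flip: complex_norm_square)
  then have "?\<phi> g \<noteq> 1"
    using g by (metis mult_right_cancel mult_zero_right restrict_apply' zero_neq_one)
  ultimately show ?thesis using that by force
qed

section \<open>Complex lines spanned by unit vectors\<close>

lemma hermitian_inner_scale:
  "hermitian_inner (c *s z) (d *s w) = c * cnj d * hermitian_inner z w"
  by (simp add: hermitian_inner_def sum_distrib_left mult_ac)

lemma norm_vector_scalar_mult_complex:
  fixes z :: "complex ^ 'n"
  shows "norm (c *s z) = cmod c * norm z"
  by (simp add: norm_vec_def norm_mult L2_set_right_distrib)

text \<open>A unit vector spanning a given line is determined up to a phase, so moduli of inner
  products depend only on the lines.\<close>

lemma unit_vector_in_span:
  fixes z w :: "complex ^ 'n"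
  assumes "norm z = 1" "norm w = 1" "vec.span {z} = vec.span {w}"
  obtains c where "z = c *s w" "cmod c = 1"
proof -
  have "z \<in> vec.span {w}" using assms(3) vec.span_base[of z "{z}"] by simp
  then obtain c where "z = c *s w" by (auto simp: vec.span_singleton)
  then show ?thesis using that assms by (auto simp: norm_vector_scalar_mult_complex)
qed

text \<open>The hypothesis \<open>a \<noteq> 1\<close> keeps the lines distinct: unit vectors on a
  common line have an inner product of modulus 1.\<close>

lemma equiangular_lines_of_unit_vectors:
  fixes z :: "'i \<Rightarrow> complex ^ 'n"
  assumes "finite I" and unit: "\<And>i. i \<in> I \<Longrightarrow> norm (z i) = 1"
    and angle: "\<And>i j. i \<in> I \<Longrightarrow> j \<in> I \<Longrightarrow> i \<noteq> j \<Longrightarrow> cmod (hermitian_inner (z i) (z j)) = a"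
    and "a \<noteq> 1"
  shows "equiangular_lines ((\<lambda>i. vec.span {z i}) ` I)"
    and "card ((\<lambda>i. vec.span {z i}) ` I) = card I"
proof -
  let ?L = "\<lambda>i. vec.span {z i}"
  have inv: "cmod (hermitian_inner x y) = cmod (hermitian_inner (z i) (z j))"
    if xy: "i \<in> I" "j \<in> I" "norm x = 1" "norm y = 1" "vec.span {x} = ?L i" "vec.span {y} = ?L j"
    for i j x y
  proof -
    obtain c where "x = c *s z i" "cmod c = 1"
      using unit_vector_in_span[OF xy(3) unit[OF xy(1)] xy(5)] .
    moreover obtain d where "y = d *s z j" "cmod d = 1"
      using unit_vector_in_span[OF xy(4) unit[OF xy(2)] xy(6)] .
    ultimately show ?thesis by (simp add: hermitian_inner_scale norm_mult)
  qed
  have "inj_on ?L I"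
  proof (rule inj_onI, rule ccontr)
    fix i j assume ij: "i \<in> I" "j \<in> I" "?L i = ?L j" "i \<noteq> j"
    \<comment> \<open>If the lines of \<open>i\<close> and \<open>j\<close> coincide,
      \<open>z i\<close> may stand in for \<open>z j\<close>, so its product with itself would have
      modulus \<open>a\<close>.\<close>
    have "cmod (hermitian_inner (z i) (z i)) = a"
      using inv[of i j "z i" "z i"] ij unit angle[of i j] by simp
    then show False using unit[OF ij(1)] \<open>a \<noteq> 1\<close> by (simp add: hermitian_inner_self)
  qed
  then show "card (?L ` I) = card I" by (rule card_image)
  have "complex_line (?L i)" if "i \<in> I" for i
  proof -
    have "z i \<noteq> 0" using unit[OF that] by auto
    then show ?thesis
      by (auto simp: complex_line_def vec.dim_span vec.dim_eq_card_independent)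
  qed
  moreover have "cmod (hermitian_inner x y) = a"
    if "i \<in> I" "j \<in> I" "?L i \<noteq> ?L j" "norm x = 1" "vec.span {x} = ?L i"
      "norm y = 1" "vec.span {y} = ?L j" for i j x y
    using inv[of i j x y] angle[of i j] that by auto
  ultimately show "equiangular_lines (?L ` I)"
    unfolding equiangular_lines_def using \<open>finite I\<close> by (auto intro!: exI[of _ a])
qed

section \<open>Equiangular lines from characters restricted to the difference set\<close>

theorem theorem2p1:
  fixes G :: "('g, 'm) monoid_scheme" and D :: "'g set" and v k :: nat
  assumes "k \<ge> 1"
    and "comm_group G" and "finite (carrier G)"
    and "difference_set G D v k 1"
    and "CARD('n::finite) = k"
  shows "\<exists>X :: (complex ^ 'n) set set. card X = v \<and> equiangular_lines X"
proof -
  interpret comm_group G by fact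
  note fin = \<open>finite (carrier G)\<close>
  have D: "D \<subseteq> carrier G" "card D = k" and v: "order G = v"
    using assms(4) by (auto simp: difference_set_def)
  obtain S where S: "S \<subseteq> characters G (carrier G)" "finite S" "card S = v"
    using exists_order_characters[OF fin] v by metis
  have "finite D" using D fin finite_subset by blast
  then obtain e :: "'n \<Rightarrow> 'g" where e: "bij_betw e UNIV D"
    using finite_same_card_bij[of "UNIV :: 'n set" D] D assms(5) by auto
  \<comment> \<open>The bijection \<open>e\<close> labels the coordinates by the elements of
    \<open>D\<close>. The \<open>k\<close> character values have modulus 1, so dividing by the root
    of \<open>k\<close> normalizes the vector.\<close>
  define z :: "('g \<Rightarrow> complex) \<Rightarrow> complex ^ 'n" where
    "z = (\<lambda>\<rho>. \<chi> i. \<rho> (e i) / of_real (sqrt k))"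
  have inner: "hermitian_inner (z \<rho>) (z \<psi>) = (\<Sum>d\<in>D. \<rho> d * cnj (\<psi> d)) / of_nat k" for \<rho> \<psi>
  proof -
    have "hermitian_inner (z \<rho>) (z \<psi>) = (\<Sum>i\<in>UNIV. \<rho> (e i) * cnj (\<psi> (e i)) / of_nat k)"
      by (simp add: hermitian_inner_def z_def flip: of_real_mult)
    also have "\<dots> = (\<Sum>d\<in>D. \<rho> d * cnj (\<psi> d) / of_nat k)"
      using sum.reindex_bij_betw[OF e, of "\<lambda>d. \<rho> d * cnj (\<psi> d) / of_nat k"] by simp
    finally show ?thesis by (simp add: sum_divide_distrib)
  qed
  have unit: "norm (z \<rho>) = 1" if "\<rho> \<in> S" for \<rho>
  proof -
    have "\<rho> d * cnj (\<rho> d) = 1" if "d \<in> D" for d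
    proof -
      have "cmod (\<rho> d) = 1" using character_norm[OF fin] that \<open>\<rho> \<in> S\<close> S(1) D(1) by blast
      then show ?thesis by (simp flip: complex_norm_square)
    qed
    then have "hermitian_inner (z \<rho>) (z \<rho>) = 1"
      using D assms(1) by (simp add: inner)
    then show ?thesis
      using power_eq_1_iff[of "norm (z \<rho>)" 2]
      by (simp add: hermitian_inner_self flip: of_real_power)
  qed
  have angle: "cmod (hermitian_inner (z \<rho>) (z \<psi>)) = sqrt (real k - 1) / real k"
    if \<rho>: "\<rho> \<in> S" "\<psi> \<in> S" "\<rho> \<noteq> \<psi>" for \<rho> \<psi>
  proof -
    obtain \<phi> g where \<phi>: "\<phi> \<in> characters G (carrier G)" "g \<in> carrier G" "\<phi> g \<noteq> 1"
      and eq: "\<And>x. x \<in> carrier G \<Longrightarrow> \<phi> x = \<rho> x * cnj (\<psi> x)"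
      using characters_quotient[OF fin _ _ \<rho>(3)] \<rho>(1,2) S(1) by blast
    have "(\<Sum>d\<in>D. \<rho> d * cnj (\<psi> d)) = (\<Sum>d\<in>D. \<phi> d)"
      using eq D by (intro sum.cong) auto
    moreover have "cmod (\<Sum>d\<in>D. \<phi> d) = sqrt (real k - 1)"
      using difference_set_character_sum[OF assms(4) \<phi>]
      by (metis norm_ge_zero of_nat_1 real_sqrt_abs abs_of_nonneg)
    ultimately show ?thesis by (simp add: inner norm_divide)
  qed
  \<comment> \<open>From k - 1 < k \<le> k^2 the common modulus is below 1, so different characters
    give different lines.\<close>
  have "sqrt (real k - 1) < sqrt ((real k)\<^sup>2)"
    using assms(1) self_le_power[of "real k" 2] by (intro real_sqrt_less_mono) linarith
  then have "sqrt (real k - 1) / real k \<noteq> 1" using assms(1) by auto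
  note lines = equiangular_lines_of_unit_vectors[of S z, OF S(2) unit angle this]
  show ?thesis
    by (rule exI[of _ "(\<lambda>\<rho>. vec.span {z \<rho>}) ` S"]) (simp add: lines S(3))
qed

end
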